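(* Let $R$ be a left diring. If $M$ and $N$ are $3$-irreducible left $R$-modules, then any $R$-homomorphism from $M$ to $N$ is either $0$ or an $R$-isomorphism. In other words, $\mathrm{End}_RM$ is a division ring.
   Context: Left dirings. A dimonoid is a nonempty set $R$ with two associative binary operations $\stackrel{\rightharpoonup}{\cdot}$ (left product) and $\stackrel{\leftharpoonup}{\cdot}$ (right product) such that for all $x,y,z$: $x\stackrel{\rightharpoonup}{\cdot}(y\stackrel{\rightharpoonup}{\cdot}z)=x\stackrel{\rightharpoonup}{\cdot}(y\stackrel{\leftharpoonup}{\cdot}z)$, $(x\stackrel{\leftharpoonup}{\cdot}y)\stackrel{\rightharpoonup}{\cdot}z=x\stackrel{\leftharpoonup}{\cdot}(y\stackrel{\rightharpoonup}{\cdot}z)$, $(x\stackrel{\rightharpoonup}{\cdot}y)\stackrel{\leftharpoonup}{\cdot}z=(x\stackrel{\leftharpoonup}{\cdot}y)\stackrel{\leftharpoonup}{\cdot}z$. A left bar-unit is an element $e$ with $e\stackrel{\leftharpoonup}{\cdot}x=x$ for all $x$. A left diring is a nonempty set $R$ with operations $+,\stackrel{\rightharpoonup}{\cdot},\stackrel{\leftharpoonup}{\cdot}$ such that $(R,+)$ is an Abelian group with identity $0$, $(R,\stackrel{\rightharpoonup}{\cdot},\stackrel{\leftharpoonup}{\cdot})$ is a dimonoid having at least one left bar-unit (called a left multiplicative bar-unit), and both products distribute over $+$ on both sides. Modules. Let $R$ be a left diring with left multiplicative bar-unit $e$. A left $R$-module is an Abelian group $M$ with two maps $R\times M\to M$,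 $(a,x)\mapsto a\stackrel{\rightharpoonup}{\odot}x$ and $(a,x)\mapsto a\stackrel{\leftharpoonup}{\odot}x$, such that for all $a,b\in R$, $x,y\in M$, $\ast\in\{\stackrel{\rightharpoonup}{\odot},\stackrel{\leftharpoonup}{\odot}\}$, $\diamond\in\{\stackrel{\rightharpoonup}{\cdot},\stackrel{\leftharpoonup}{\cdot}\}$: $a\ast(x+y)=a\ast x+a\ast y$; $(a+b)\ast x=a\ast x+b\ast x$; $(a\stackrel{\rightharpoonup}{\cdot}b)\stackrel{\rightharpoonup}{\odot}x=a\stackrel{\rightharpoonup}{\odot}(b\ast x)$; $(a\stackrel{\leftharpoonup}{\cdot}b)\stackrel{\rightharpoonup}{\odot}x=a\stackrel{\leftharpoonup}{\odot}(b\stackrel{\rightharpoonup}{\odot}x)$; $(a\diamond b)\stackrel{\leftharpoonup}{\odot}x=a\stackrel{\leftharpoonup}{\odot}(b\stackrel{\leftharpoonup}{\odot}x)$; $e\stackrel{\leftharpoonup}{\odot}x=x$. A submodule is a subgroup closed under both actions of all $a\in R$. The additive halo of $M$ is the submodule $\hbar^+(M)=\{x\in M: e\stackrel{\rightharpoonup}{\odot}x=0\}$ (the module axioms and $\hbar^+(M)$ do not depend on the choice of $e$). $M$ is $3$-irreducible if $\hbar^+(M)$ is the unique submodule $N$ of $M$ with $N\neq 0$ and $N\neq M$ (so in particular $0\ne\hbar^+(M)\neq M$). An $R$-homomorphism $\phi:M\to\bar M$ is an additive map with $\phi(a\ast x)=a\ast\phi(x)$ for all $a\in R$, $x\in M$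 and both actions $\ast$; an $R$-isomorphism is a bijective $R$-homomorphism. $\mathrm{End}_RM$ is the ring of $R$-homomorphisms $M\to M$ under pointwise addition and composition. *)

theory Defs
  imports "HOL-Algebra.AbelCoset"
begin

(* As for records of type module in HOL-Algebra, additive groups are represented by the
   additive part of a ring record; the inherited fields mult and one carry no meaning in
   the two records below. *)

record 'a diring = "'a ring" +
  lprod :: "['a, 'a] \<Rightarrow> 'a" (infixl "\<rightharpoonup>\<index>" 70)
  rprod :: "['a, 'a] \<Rightarrow> 'a" (infixl "\<leftharpoonup>\<index>" 70)

record ('a, 'b) dimodule = "'b ring" +
  lact :: "['a, 'b] \<Rightarrow> 'b" (infixr "\<rightharpoonup>\<odot>\<index>" 75)
  ract :: "['a, 'b] \<Rightarrow> 'b" (infixr "\<leftharpoonup>\<odot>\<index>" 75)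


locale dimonoid =
  fixes R (structure)
  assumes carrier_nonempty: "carrier R \<noteq> {}"
    and lprod_closed: "\<lbrakk>x \<in> carrier R; y \<in> carrier R\<rbrakk> \<Longrightarrow> x \<rightharpoonup> y \<in> carrier R"
    and rprod_closed: "\<lbrakk>x \<in> carrier R; y \<in> carrier R\<rbrakk> \<Longrightarrow> x \<leftharpoonup> y \<in> carrier R"
    and lprod_assoc: "\<lbrakk>x \<in> carrier R; y \<in> carrier R; z \<in> carrier R\<rbrakk>
      \<Longrightarrow> (x \<rightharpoonup> y) \<rightharpoonup> z = x \<rightharpoonup> (y \<rightharpoonup> z)"
    and rprod_assoc: "\<lbrakk>x \<in> carrier R; y \<in> carrier R; z \<in> carrier R\<rbrakk>
      \<Longrightarrow> (x \<leftharpoonup> y) \<leftharpoonup> z = x \<leftharpoonup> (y \<leftharpoonup> z)"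
    and lprod_lprod_rprod: "\<lbrakk>x \<in> carrier R; y \<in> carrier R; z \<in> carrier R\<rbrakk>
      \<Longrightarrow> x \<rightharpoonup> (y \<rightharpoonup> z) = x \<rightharpoonup> (y \<leftharpoonup> z)"
    and rprod_lprod_assoc: "\<lbrakk>x \<in> carrier R; y \<in> carrier R; z \<in> carrier R\<rbrakk>
      \<Longrightarrow> (x \<leftharpoonup> y) \<rightharpoonup> z = x \<leftharpoonup> (y \<rightharpoonup> z)"
    and lprod_rprod_rprod: "\<lbrakk>x \<in> carrier R; y \<in> carrier R; z \<in> carrier R\<rbrakk>
      \<Longrightarrow> (x \<rightharpoonup> y) \<leftharpoonup> z = (x \<leftharpoonup> y) \<leftharpoonup> z"

definition left_bar_units :: "('a, 'm) diring_scheme \<Rightarrow> 'a set" where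
  "left_bar_units R = {e \<in> carrier R. \<forall>x \<in> carrier R. e \<leftharpoonup>\<^bsub>R\<^esub> x = x}"

locale left_diring = abelian_group R + dimonoid R for R (structure) +
  assumes ex_left_bar_unit: "left_bar_units R \<noteq> {}"
    and lprod_add_right: "\<lbrakk>x \<in> carrier R; y \<in> carrier R; z \<in> carrier R\<rbrakk>
      \<Longrightarrow> x \<rightharpoonup> (y \<oplus> z) = (x \<rightharpoonup> y) \<oplus> (x \<rightharpoonup> z)"
    and lprod_add_left: "\<lbrakk>x \<in> carrier R; y \<in> carrier R; z \<in> carrier R\<rbrakk>
      \<Longrightarrow> (x \<oplus> y) \<rightharpoonup> z = (x \<rightharpoonup> z) \<oplus> (y \<rightharpoonup> z)"
    and rprod_add_right: "\<lbrakk>x \<in> carrier R; y \<in> carrier R; z \<in> carrier R\<rbrakk>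
      \<Longrightarrow> x \<leftharpoonup> (y \<oplus> z) = (x \<leftharpoonup> y) \<oplus> (x \<leftharpoonup> z)"
    and rprod_add_left: "\<lbrakk>x \<in> carrier R; y \<in> carrier R; z \<in> carrier R\<rbrakk>
      \<Longrightarrow> (x \<oplus> y) \<leftharpoonup> z = (x \<leftharpoonup> z) \<oplus> (y \<leftharpoonup> z)"

locale left_dimodule = R?: left_diring R + M?: abelian_group M
  for R (structure) and e and M (structure) +
  assumes bar_unit: "e \<in> left_bar_units R"
    and lact_closed: "\<lbrakk>a \<in> carrier R; x \<in> carrier M\<rbrakk> \<Longrightarrow> a \<rightharpoonup>\<odot>\<^bsub>M\<^esub> x \<in> carrier M"
    and ract_closed: "\<lbrakk>a \<in> carrier R; x \<in> carrier M\<rbrakk> \<Longrightarrow> a \<leftharpoonup>\<odot>\<^bsub>M\<^esub> x \<in> carrier M"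
    and lact_add_right: "\<lbrakk>a \<in> carrier R; x \<in> carrier M; y \<in> carrier M\<rbrakk>
      \<Longrightarrow> a \<rightharpoonup>\<odot>\<^bsub>M\<^esub> (x \<oplus>\<^bsub>M\<^esub> y) = (a \<rightharpoonup>\<odot>\<^bsub>M\<^esub> x) \<oplus>\<^bsub>M\<^esub> (a \<rightharpoonup>\<odot>\<^bsub>M\<^esub> y)"
    and ract_add_right: "\<lbrakk>a \<in> carrier R; x \<in> carrier M; y \<in> carrier M\<rbrakk>
      \<Longrightarrow> a \<leftharpoonup>\<odot>\<^bsub>M\<^esub> (x \<oplus>\<^bsub>M\<^esub> y) = (a \<leftharpoonup>\<odot>\<^bsub>M\<^esub> x) \<oplus>\<^bsub>M\<^esub> (a \<leftharpoonup>\<odot>\<^bsub>M\<^esub> y)"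
    and lact_add_left: "\<lbrakk>a \<in> carrier R; b \<in> carrier R; x \<in> carrier M\<rbrakk>
      \<Longrightarrow> (a \<oplus>\<^bsub>R\<^esub> b) \<rightharpoonup>\<odot>\<^bsub>M\<^esub> x = (a \<rightharpoonup>\<odot>\<^bsub>M\<^esub> x) \<oplus>\<^bsub>M\<^esub> (b \<rightharpoonup>\<odot>\<^bsub>M\<^esub> x)"
    and ract_add_left: "\<lbrakk>a \<in> carrier R; b \<in> carrier R; x \<in> carrier M\<rbrakk>
      \<Longrightarrow> (a \<oplus>\<^bsub>R\<^esub> b) \<leftharpoonup>\<odot>\<^bsub>M\<^esub> x = (a \<leftharpoonup>\<odot>\<^bsub>M\<^esub> x) \<oplus>\<^bsub>M\<^esub> (b \<leftharpoonup>\<odot>\<^bsub>M\<^esub> x)"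
    and lprod_lact_lact: "\<lbrakk>a \<in> carrier R; b \<in> carrier R; x \<in> carrier M\<rbrakk>
      \<Longrightarrow> (a \<rightharpoonup>\<^bsub>R\<^esub> b) \<rightharpoonup>\<odot>\<^bsub>M\<^esub> x = a \<rightharpoonup>\<odot>\<^bsub>M\<^esub> (b \<rightharpoonup>\<odot>\<^bsub>M\<^esub> x)"
    and lprod_lact_ract: "\<lbrakk>a \<in> carrier R; b \<in> carrier R; x \<in> carrier M\<rbrakk>
      \<Longrightarrow> (a \<rightharpoonup>\<^bsub>R\<^esub> b) \<rightharpoonup>\<odot>\<^bsub>M\<^esub> x = a \<rightharpoonup>\<odot>\<^bsub>M\<^esub> (b \<leftharpoonup>\<odot>\<^bsub>M\<^esub> x)"
    and rprod_lact: "\<lbrakk>a \<in> carrier R; b \<in> carrier R; x \<in> carrier M\<rbrakk>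
      \<Longrightarrow> (a \<leftharpoonup>\<^bsub>R\<^esub> b) \<rightharpoonup>\<odot>\<^bsub>M\<^esub> x = a \<leftharpoonup>\<odot>\<^bsub>M\<^esub> (b \<rightharpoonup>\<odot>\<^bsub>M\<^esub> x)"
    and lprod_ract: "\<lbrakk>a \<in> carrier R; b \<in> carrier R; x \<in> carrier M\<rbrakk>
      \<Longrightarrow> (a \<rightharpoonup>\<^bsub>R\<^esub> b) \<leftharpoonup>\<odot>\<^bsub>M\<^esub> x = a \<leftharpoonup>\<odot>\<^bsub>M\<^esub> (b \<leftharpoonup>\<odot>\<^bsub>M\<^esub> x)"
    and rprod_ract: "\<lbrakk>a \<in> carrier R; b \<in> carrier R; x \<in> carrier M\<rbrakk>
      \<Longrightarrow> (a \<leftharpoonup>\<^bsub>R\<^esub> b) \<leftharpoonup>\<odot>\<^bsub>M\<^esub> x = a \<leftharpoonup>\<odot>\<^bsub>M\<^esub> (b \<leftharpoonup>\<odot>\<^bsub>M\<^esub> x)"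
    and bar_unit_ract: "x \<in> carrier M \<Longrightarrow> e \<leftharpoonup>\<odot>\<^bsub>M\<^esub> x = x"

definition disubmodule ::
  "('a, 'm) diring_scheme \<Rightarrow> 'b set \<Rightarrow> ('a, 'b, 'n) dimodule_scheme \<Rightarrow> bool" where
  "disubmodule R N M \<longleftrightarrow> additive_subgroup N M \<and>
     (\<forall>a \<in> carrier R. \<forall>x \<in> N. a \<rightharpoonup>\<odot>\<^bsub>M\<^esub> x \<in> N \<and> a \<leftharpoonup>\<odot>\<^bsub>M\<^esub> x \<in> N)"

definition add_halo :: "'a \<Rightarrow> ('a, 'b, 'n) dimodule_scheme \<Rightarrow> 'b set" where
  "add_halo e M = {x \<in> carrier M. e \<rightharpoonup>\<odot>\<^bsub>M\<^esub> x = \<zero>\<^bsub>M\<^esub>}"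

definition three_irreducible ::
  "('a, 'm) diring_scheme \<Rightarrow> 'a \<Rightarrow> ('a, 'b, 'n) dimodule_scheme \<Rightarrow> bool" where
  "three_irreducible R e M \<longleftrightarrow> left_dimodule R e M \<and>
     (\<forall>N. disubmodule R N M \<and> N \<noteq> {\<zero>\<^bsub>M\<^esub>} \<and> N \<noteq> carrier M \<longleftrightarrow> N = add_halo e M)"

(* The choice of the bar-unit does not matter. *)

lemma left_dimodule_bar_unit_cong:
  assumes "left_dimodule R e M" and "e' \<in> left_bar_units R"
  shows "left_dimodule R e' M"
proof -
  interpret left_dimodule R e M by fact
  have e: "e \<in> carrier R" "e' \<in> carrier R" "e' \<leftharpoonup>\<^bsub>R\<^esub> e = e"
    using bar_unit assms(2) by (auto simp: left_bar_units_def)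
  have e'_ract: "e' \<leftharpoonup>\<odot>\<^bsub>M\<^esub> x = x" if "x \<in> carrier M" for x
    using rprod_ract[OF e(2,1) that] e(3) that by (simp add: bar_unit_ract)
  show ?thesis
    by unfold_locales
      (fact assms(2) lact_closed ract_closed lact_add_right ract_add_right lact_add_left
        ract_add_left lprod_lact_lact lprod_lact_ract rprod_lact lprod_ract rprod_ract e'_ract)+
qed

lemma (in left_dimodule) lact_add_halo:
  assumes "a \<in> carrier R" and "x \<in> add_halo e M"
  shows "a \<rightharpoonup>\<odot>\<^bsub>M\<^esub> x = \<zero>\<^bsub>M\<^esub>"
proof -
  have e: "e \<in> carrier R" using bar_unit by (auto simp: left_bar_units_def)
  have x: "x \<in> carrier M" "e \<rightharpoonup>\<odot>\<^bsub>M\<^esub> x = \<zero>\<^bsub>M\<^esub>"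
    using assms(2) by (auto simp: add_halo_def)
  have "a \<rightharpoonup>\<odot>\<^bsub>M\<^esub> x = a \<rightharpoonup>\<odot>\<^bsub>M\<^esub> (e \<leftharpoonup>\<odot>\<^bsub>M\<^esub> x)"
    using x by (simp add: bar_unit_ract)
  also have "\<dots> = a \<rightharpoonup>\<odot>\<^bsub>M\<^esub> \<zero>\<^bsub>M\<^esub>"
    using lprod_lact_lact[OF assms(1) e x(1)] lprod_lact_ract[OF assms(1) e x(1)] x by simp
  also have "\<dots> = \<zero>\<^bsub>M\<^esub>"
    using lact_add_right[OF assms(1) M.zero_closed M.zero_closed]
      lact_closed[OF assms(1) M.zero_closed]
    by simp
  finally show ?thesis .
qed

lemma add_halo_bar_unit_cong:
  assumes "left_dimodule R e M" and "e' \<in> left_bar_units R"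
  shows "add_halo e' M = add_halo e M"
proof -
  have "e \<in> carrier R" "e' \<in> carrier R"
    using left_dimodule.bar_unit[OF assms(1)] assms(2) by (auto simp: left_bar_units_def)
  then have "x \<in> add_halo e' M \<longleftrightarrow> x \<in> add_halo e M" if "x \<in> carrier M" for x
    using left_dimodule.lact_add_halo[OF assms(1)] that
      left_dimodule.lact_add_halo[OF left_dimodule_bar_unit_cong[OF assms]]
    unfolding add_halo_def by blast
  then show ?thesis
    unfolding add_halo_def by blast
qed

(* Homomorphisms are taken to be extensional (undefined outside the carrier), so that equality
   of functions is equality on the carrier and the endomorphisms literally form a ring. *)

definition dimodule_hom ::
  "('a, 'm) diring_scheme \<Rightarrow> ('a, 'b, 'n) dimodule_scheme \<Rightarrow> ('a, 'c, 'k) dimodule_scheme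
     \<Rightarrow> ('b \<Rightarrow> 'c) set" where
  "dimodule_hom R M N = {\<phi> \<in> carrier M \<rightarrow>\<^sub>E carrier N.
     (\<forall>x \<in> carrier M. \<forall>y \<in> carrier M. \<phi> (x \<oplus>\<^bsub>M\<^esub> y) = \<phi> x \<oplus>\<^bsub>N\<^esub> \<phi> y) \<and>
     (\<forall>a \<in> carrier R. \<forall>x \<in> carrier M.
        \<phi> (a \<rightharpoonup>\<odot>\<^bsub>M\<^esub> x) = a \<rightharpoonup>\<odot>\<^bsub>N\<^esub> \<phi> x \<and> \<phi> (a \<leftharpoonup>\<odot>\<^bsub>M\<^esub> x) = a \<leftharpoonup>\<odot>\<^bsub>N\<^esub> \<phi> x)}"

definition dimodule_iso ::
  "('a, 'm) diring_scheme \<Rightarrow> ('a, 'b, 'n) dimodule_scheme \<Rightarrow> ('a, 'c, 'k) dimodule_scheme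
     \<Rightarrow> ('b \<Rightarrow> 'c) set" where
  "dimodule_iso R M N = {\<phi> \<in> dimodule_hom R M N. bij_betw \<phi> (carrier M) (carrier N)}"

definition zero_hom ::
  "('a, 'b, 'n) dimodule_scheme \<Rightarrow> ('a, 'c, 'k) dimodule_scheme \<Rightarrow> 'b \<Rightarrow> 'c" where
  "zero_hom M N = (\<lambda>x \<in> carrier M. \<zero>\<^bsub>N\<^esub>)"

definition End_ring ::
  "('a, 'm) diring_scheme \<Rightarrow> ('a, 'b, 'n) dimodule_scheme \<Rightarrow> ('b \<Rightarrow> 'b) ring" where
  "End_ring R M =
     \<lparr>carrier = dimodule_hom R M M,
      mult = (\<lambda>\<phi> \<psi>. compose (carrier M) \<phi> \<psi>),
      one = (\<lambda>x \<in> carrier M. x),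
      zero = zero_hom M M,
      add = (\<lambda>\<phi> \<psi>. \<lambda>x \<in> carrier M. \<phi> x \<oplus>\<^bsub>M\<^esub> \<psi> x)\<rparr>"

locale division_ring = ring D for D (structure) +
  assumes one_not_zero: "\<one> \<noteq> \<zero>"
    and division_ring_Units: "Units D = carrier D - {\<zero>}"

end

(* Schur's argument, with the halo as the only obstacle. If the kernel of a homomorphism \<phi>
   contains the halo, then e \<rightharpoonup>\<odot> x - x, which lies in the halo of M, is killed by \<phi>; hence e acts from
   the left as the identity on the image, so the image meets the halo of N trivially and must
   be 0. Otherwise the kernel is 0 and the image, being nonzero, is the halo of N or N; the
   former is impossible because e acts from the left as zero on it, but not on M. *)

theory Submission
  imports Defs
begin

section \<open>The left action of a bar-unit on a module\<close>

context left_dimodule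
begin

lemma bar_unit_closed: "e \<in> carrier R"
  using bar_unit by (simp add: left_bar_units_def)

lemma lact_zero: "a \<in> carrier R \<Longrightarrow> a \<rightharpoonup>\<odot>\<^bsub>M\<^esub> \<zero>\<^bsub>M\<^esub> = \<zero>\<^bsub>M\<^esub>"
  using lact_add_right[of a "\<zero>\<^bsub>M\<^esub>" "\<zero>\<^bsub>M\<^esub>"] lact_closed[of a "\<zero>\<^bsub>M\<^esub>"] by simp

lemma ract_zero: "a \<in> carrier R \<Longrightarrow> a \<leftharpoonup>\<odot>\<^bsub>M\<^esub> \<zero>\<^bsub>M\<^esub> = \<zero>\<^bsub>M\<^esub>"
  using ract_add_right[of a "\<zero>\<^bsub>M\<^esub>" "\<zero>\<^bsub>M\<^esub>"] ract_closed[of a "\<zero>\<^bsub>M\<^esub>"] by simp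

lemma lact_uminus:
  "\<lbrakk>a \<in> carrier R; x \<in> carrier M\<rbrakk> \<Longrightarrow> a \<rightharpoonup>\<odot>\<^bsub>M\<^esub> (\<ominus>\<^bsub>M\<^esub> x) = \<ominus>\<^bsub>M\<^esub> (a \<rightharpoonup>\<odot>\<^bsub>M\<^esub> x)"
  using lact_add_right[of a "\<ominus>\<^bsub>M\<^esub> x" x]
  by (intro M.minus_equality[symmetric]) (simp_all add: lact_closed lact_zero M.l_neg)

lemma ract_uminus:
  "\<lbrakk>a \<in> carrier R; x \<in> carrier M\<rbrakk> \<Longrightarrow> a \<leftharpoonup>\<odot>\<^bsub>M\<^esub> (\<ominus>\<^bsub>M\<^esub> x) = \<ominus>\<^bsub>M\<^esub> (a \<leftharpoonup>\<odot>\<^bsub>M\<^esub> x)"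
  using ract_add_right[of a "\<ominus>\<^bsub>M\<^esub> x" x]
  by (intro M.minus_equality[symmetric]) (simp_all add: ract_closed ract_zero M.l_neg)

text \<open>After an outer left action the two inner actions agree, both giving the left action of
  the product of \<open>e\<close> with itself; the inner \<open>\<leftharpoonup>\<odot>\<close>
  action of \<open>e\<close> is the identity.\<close>

lemma bar_unit_lact_idem: "x \<in> carrier M \<Longrightarrow> e \<rightharpoonup>\<odot>\<^bsub>M\<^esub> (e \<rightharpoonup>\<odot>\<^bsub>M\<^esub> x) = e \<rightharpoonup>\<odot>\<^bsub>M\<^esub> x"
  using lprod_lact_lact[of e e x] lprod_lact_ract[of e e x]
  by (simp add: bar_unit_closed bar_unit_ract)

text \<open>Idempotence makes \<open>e\<close> kill the difference. These elements measure how far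
  the left action of \<open>e\<close> is from the identity.\<close>

lemma bar_unit_lact_minus_in_add_halo:
  "x \<in> carrier M \<Longrightarrow> e \<rightharpoonup>\<odot>\<^bsub>M\<^esub> x \<oplus>\<^bsub>M\<^esub> \<ominus>\<^bsub>M\<^esub> x \<in> add_halo e M"
  by (simp add: add_halo_def bar_unit_closed lact_closed lact_add_right lact_uminus
      bar_unit_lact_idem M.r_neg)

end

section \<open>Submodules of a 3-irreducible module\<close>

context
  fixes R :: "('a, 'm) diring_scheme" and e :: 'a and M :: "('a, 'b, 'n) dimodule_scheme"
  assumes irr: "three_irreducible R e M"
begin

lemma three_irreducible_cases:
  "disubmodule R S M \<Longrightarrow> S = {\<zero>\<^bsub>M\<^esub>} \<or> S = add_halo e M \<or> S = carrier M"
  using irr unfolding three_irreducible_def by blast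

text \<open>The equivalence in \<open>three_irreducible\<close>, read at the halo itself.\<close>

lemma three_irreducible_add_halo:
  "add_halo e M \<noteq> {\<zero>\<^bsub>M\<^esub>}" "add_halo e M \<noteq> carrier M"
  using irr unfolding three_irreducible_def by blast+

end

section \<open>Homomorphisms, their kernels and their images\<close>

lemma dimodule_homI:
  assumes "\<And>x. x \<in> carrier M \<Longrightarrow> \<phi> x \<in> carrier N"
    and "\<phi> \<in> extensional (carrier M)"
    and "\<And>x y. \<lbrakk>x \<in> carrier M; y \<in> carrier M\<rbrakk> \<Longrightarrow> \<phi> (x \<oplus>\<^bsub>M\<^esub> y) = \<phi> x \<oplus>\<^bsub>N\<^esub> \<phi> y"
    and "\<And>a x. \<lbrakk>a \<in> carrier R; x \<in> carrier M\<rbrakk> \<Longrightarrow> \<phi> (a \<rightharpoonup>\<odot>\<^bsub>M\<^esub> x) = a \<rightharpoonup>\<odot>\<^bsub>N\<^esub> \<phi> x"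
    and "\<And>a x. \<lbrakk>a \<in> carrier R; x \<in> carrier M\<rbrakk> \<Longrightarrow> \<phi> (a \<leftharpoonup>\<odot>\<^bsub>M\<^esub> x) = a \<leftharpoonup>\<odot>\<^bsub>N\<^esub> \<phi> x"
  shows "\<phi> \<in> dimodule_hom R M N"
  using assms by (auto simp: dimodule_hom_def PiE_def)

lemma dimodule_homD:
  assumes "\<phi> \<in> dimodule_hom R M N"
  shows "x \<in> carrier M \<Longrightarrow> \<phi> x \<in> carrier N"
    and "\<phi> \<in> extensional (carrier M)"
    and "\<lbrakk>x \<in> carrier M; y \<in> carrier M\<rbrakk> \<Longrightarrow> \<phi> (x \<oplus>\<^bsub>M\<^esub> y) = \<phi> x \<oplus>\<^bsub>N\<^esub> \<phi> y"
    and "\<lbrakk>a \<in> carrier R; x \<in> carrier M\<rbrakk> \<Longrightarrow> \<phi> (a \<rightharpoonup>\<odot>\<^bsub>M\<^esub> x) = a \<rightharpoonup>\<odot>\<^bsub>N\<^esub> \<phi> x"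
    and "\<lbrakk>a \<in> carrier R; x \<in> carrier M\<rbrakk> \<Longrightarrow> \<phi> (a \<leftharpoonup>\<odot>\<^bsub>M\<^esub> x) = a \<leftharpoonup>\<odot>\<^bsub>N\<^esub> \<phi> x"
  using assms by (auto simp: dimodule_hom_def PiE_def)

text \<open>Both modules share one \<open>e\<close>, so \<phi> carries the left action of
  \<open>e\<close> on \<open>M\<close> to that on \<open>N\<close>, and the two halos can be
  compared.\<close>

locale left_dimodule_hom =
  dom: left_dimodule R e M + cod: left_dimodule R e N
  for R (structure) and e and M (structure) and N (structure) +
  fixes \<phi>
  assumes hom: "\<phi> \<in> dimodule_hom R M N"
begin

text \<open>Supplies kernel and image as subgroups; only closure under the two actions then remains
  to be checked.\<close>

sublocale abelian_group_hom M N \<phi>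
proof (rule abelian_group_homI)
  show "group_hom (add_monoid M) (add_monoid N) \<phi>"
    using dom.M.a_group cod.M.a_group dimodule_homD[OF hom]
    by (auto simp: group_hom_def group_hom_axioms_def Group.hom_def)
qed (rule dom.M.abelian_group_axioms cod.M.abelian_group_axioms)+

lemma disubmodule_kernel: "disubmodule R (a_kernel M N \<phi>) M"
  unfolding disubmodule_def
proof (intro conjI ballI)
  fix a x
  assume "a \<in> carrier R" "x \<in> a_kernel M N \<phi>"
  then show "a \<rightharpoonup>\<odot>\<^bsub>M\<^esub> x \<in> a_kernel M N \<phi>" "a \<leftharpoonup>\<odot>\<^bsub>M\<^esub> x \<in> a_kernel M N \<phi>"
    by (simp_all add: a_kernel_def' dimodule_homD[OF hom] dom.lact_closed dom.ract_closed
        cod.lact_zero cod.ract_zero)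
qed (rule additive_subgroup_a_kernel)

lemma disubmodule_image: "disubmodule R (\<phi> ` carrier M) N"
  unfolding disubmodule_def
proof (intro conjI ballI)
  show "additive_subgroup (\<phi> ` carrier M) N"
    using group_hom.img_is_subgroup[OF a_group_hom] by (simp add: additive_subgroup_def)
next
  fix a y
  assume "a \<in> carrier R" "y \<in> \<phi> ` carrier M"
  then show "a \<rightharpoonup>\<odot>\<^bsub>N\<^esub> y \<in> \<phi> ` carrier M" "a \<leftharpoonup>\<odot>\<^bsub>N\<^esub> y \<in> \<phi> ` carrier M"
    by (auto simp: dimodule_homD(4,5)[OF hom, symmetric] dom.lact_closed dom.ract_closed)
qed

lemma eq_zero_homI: "(\<And>x. x \<in> carrier M \<Longrightarrow> \<phi> x = \<zero>\<^bsub>N\<^esub>) \<Longrightarrow> \<phi> = zero_hom M N"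
  using dimodule_homD(2)[OF hom] by (auto simp: zero_hom_def extensional_def)

lemma bar_unit_lact_image:
  assumes "add_halo e M \<subseteq> a_kernel M N \<phi>" and "x \<in> carrier M"
  shows "e \<rightharpoonup>\<odot>\<^bsub>N\<^esub> \<phi> x = \<phi> x"
proof -
  have "\<phi> (e \<rightharpoonup>\<odot>\<^bsub>M\<^esub> x \<oplus>\<^bsub>M\<^esub> \<ominus>\<^bsub>M\<^esub> x) = \<zero>\<^bsub>N\<^esub>"
    using dom.bar_unit_lact_minus_in_add_halo assms by (auto simp: a_kernel_def')
  then have "e \<rightharpoonup>\<odot>\<^bsub>N\<^esub> \<phi> x \<oplus>\<^bsub>N\<^esub> \<ominus>\<^bsub>N\<^esub> \<phi> x = \<zero>\<^bsub>N\<^esub>"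
    using assms(2) dom.bar_unit_closed by (simp add: dom.lact_closed dimodule_homD(4)[OF hom])
  then show ?thesis
    using assms(2) cod.M.minus_equality[of "e \<rightharpoonup>\<odot>\<^bsub>N\<^esub> \<phi> x" "\<ominus>\<^bsub>N\<^esub> \<phi> x"]
    by (simp add: cod.lact_closed dom.bar_unit_closed)
qed

lemma schur:
  assumes M: "three_irreducible R e M" and N: "three_irreducible R e N"
  shows "\<phi> = zero_hom M N \<or> \<phi> \<in> dimodule_iso R M N"
proof (cases "add_halo e M \<subseteq> a_kernel M N \<phi>")
  case True
  \<comment> \<open>A common element is both fixed and sent to zero by the left action of
    \<open>e\<close>.\<close>
  have "\<phi> ` carrier M \<inter> add_halo e N \<subseteq> {\<zero>\<^bsub>N\<^esub>}"
    using bar_unit_lact_image[OF True] by (auto simp: add_halo_def)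
  moreover have "\<zero>\<^bsub>N\<^esub> \<in> add_halo e N" "add_halo e N \<subseteq> carrier N"
    by (auto simp: add_halo_def cod.lact_zero cod.bar_unit_closed)
  \<comment> \<open>An image equal to the halo or to all of \<open>N\<close> would contain the halo,
    forcing the halo to be zero.\<close>
  ultimately have "\<phi> ` carrier M = {\<zero>\<^bsub>N\<^esub>}"
    using three_irreducible_cases[OF N disubmodule_image] three_irreducible_add_halo[OF N] by blast
  then show ?thesis
    using eq_zero_homI by blast
next
  case False
  moreover have "add_halo e M \<subseteq> carrier M"
    by (auto simp: add_halo_def)
  \<comment> \<open>The other two possible kernels, the halo and \<open>M\<close>, both contain the
    halo.\<close>
  ultimately have ker: "a_kernel M N \<phi> = {\<zero>\<^bsub>M\<^esub>}"
    using three_irreducible_cases[OF M disubmodule_kernel] by blast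
  then have inj: "inj_on \<phi> (carrier M)"
    using group_hom.trivial_ker_imp_inj[OF a_group_hom] by (simp add: a_kernel_def)
  have "\<phi> ` carrier M \<noteq> add_halo e N"
  proof
    assume im: "\<phi> ` carrier M = add_halo e N"
    \<comment> \<open>Here \<phi> maps \<open>e \<rightharpoonup>\<odot> x\<close> to zero and has
      trivial kernel. The halo of \<open>M\<close> would then be all of \<open>M\<close>.\<close>
    have "e \<rightharpoonup>\<odot>\<^bsub>M\<^esub> x = \<zero>\<^bsub>M\<^esub>" if "x \<in> carrier M" for x
    proof -
      have "\<phi> x \<in> add_halo e N"
        using im that by blast
      then have "e \<rightharpoonup>\<odot>\<^bsub>M\<^esub> x \<in> a_kernel M N \<phi>"
        using that by (simp add: add_halo_def a_kernel_def' dimodule_homD(4)[OF hom]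
            dom.lact_closed dom.bar_unit_closed)
      then show ?thesis
        using ker by blast
    qed
    then show False
      using three_irreducible_add_halo(2)[OF M] by (auto simp: add_halo_def)
  qed
  moreover have "\<phi> ` carrier M \<noteq> {\<zero>\<^bsub>N\<^esub>}"
  proof
    assume "\<phi> ` carrier M = {\<zero>\<^bsub>N\<^esub>}"
    then have "carrier M \<subseteq> a_kernel M N \<phi>"
      by (auto simp: a_kernel_def')
    then show False
      using False \<open>add_halo e M \<subseteq> carrier M\<close> by blast
  qed
  ultimately have "\<phi> ` carrier M = carrier N"
    using three_irreducible_cases[OF N disubmodule_image] by blast
  then show ?thesis
    using inj hom by (simp add: dimodule_iso_def bij_betw_def)
qed

text \<open>By injectivity, each law for the inverse follows from the same law for \<phi>. The
  restriction to \<open>carrier N\<close> makes the inverse extensional.\<close>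

lemma inverse_hom:
  assumes "\<phi> \<in> dimodule_iso R M N"
  shows "restrict (inv_into (carrier M) \<phi>) (carrier N) \<in> dimodule_hom R N M"
proof -
  let ?\<psi> = "inv_into (carrier M) \<phi>"
  have bij: "bij_betw \<phi> (carrier M) (carrier N)"
    using assms by (simp add: dimodule_iso_def)
  have closed: "?\<psi> y \<in> carrier M" and right: "\<phi> (?\<psi> y) = y" if "y \<in> carrier N" for y
    using bij that by (auto simp: bij_betw_def inv_into_into f_inv_into_f)
  \<comment> \<open>A value of the inverse is identified by exhibiting a preimage; used as an
    introduction rule, this turns goals about \<open>?\<psi>\<close> into goals about
    \<phi>.\<close>
  have eqI: "?\<psi> y = x" if "x \<in> carrier M" "\<phi> x = y" for x y
    using bij that by (auto simp: bij_betw_def)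
  show ?thesis
    by (rule dimodule_homI)
      (auto simp: closed right dimodule_homD(4,5)[OF hom] dom.lact_closed dom.ract_closed
        cod.lact_closed cod.ract_closed intro!: eqI)
qed

end

section \<open>The endomorphism ring\<close>

context left_dimodule
begin

lemma left_dimodule_hom_self: "\<phi> \<in> dimodule_hom R M M \<Longrightarrow> left_dimodule_hom R e M M \<phi>"
  by (intro left_dimodule_hom.intro left_dimodule_hom_axioms.intro left_dimodule_axioms)

lemma zero_hom_closed: "zero_hom M M \<in> dimodule_hom R M M"
  by (rule dimodule_homI)
    (auto simp: zero_hom_def lact_closed ract_closed lact_zero ract_zero)

lemma id_hom: "(\<lambda>x \<in> carrier M. x) \<in> dimodule_hom R M M"
  by (rule dimodule_homI) (auto simp: lact_closed ract_closed)

lemma compose_hom: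
  assumes "\<phi> \<in> dimodule_hom R M M" and "\<psi> \<in> dimodule_hom R M M"
  shows "compose (carrier M) \<phi> \<psi> \<in> dimodule_hom R M M"
  by (rule dimodule_homI)
    (auto simp: compose_def lact_closed ract_closed dimodule_homD[OF assms(1)]
      dimodule_homD[OF assms(2)])

lemma add_hom:
  assumes "\<phi> \<in> dimodule_hom R M M" and "\<psi> \<in> dimodule_hom R M M"
  shows "(\<lambda>x \<in> carrier M. \<phi> x \<oplus>\<^bsub>M\<^esub> \<psi> x) \<in> dimodule_hom R M M"
  by (rule dimodule_homI)
    (auto simp: lact_closed ract_closed lact_add_right ract_add_right M.a_ac
      dimodule_homD[OF assms(1)] dimodule_homD[OF assms(2)])

lemma uminus_hom:
  assumes "\<phi> \<in> dimodule_hom R M M"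
  shows "(\<lambda>x \<in> carrier M. \<ominus>\<^bsub>M\<^esub> \<phi> x) \<in> dimodule_hom R M M"
  by (rule dimodule_homI)
    (auto simp: lact_closed ract_closed lact_uminus ract_uminus M.minus_add
      dimodule_homD[OF assms])

lemma ring_End_ring: "ring (End_ring R M)"
proof (rule ringI)
  show "abelian_group (End_ring R M)"
  proof (rule abelian_groupI)
    fix \<phi>
    assume \<phi>: "\<phi> \<in> carrier (End_ring R M)"
    show "\<exists>\<psi> \<in> carrier (End_ring R M). \<psi> \<oplus>\<^bsub>End_ring R M\<^esub> \<phi> = \<zero>\<^bsub>End_ring R M\<^esub>"
      using \<phi> uminus_hom[of \<phi>] dimodule_homD(1)[of \<phi> R M M]
      by (intro bexI[of _ "\<lambda>x \<in> carrier M. \<ominus>\<^bsub>M\<^esub> \<phi> x"])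
        (auto simp: End_ring_def zero_hom_def M.l_neg intro!: restrict_ext)
    \<comment> \<open>The sum is a restricted function, so it equals \<phi> itself only because
      \<phi> is extensional.\<close>
    show "\<zero>\<^bsub>End_ring R M\<^esub> \<oplus>\<^bsub>End_ring R M\<^esub> \<phi> = \<phi>"
      using \<phi> by (auto simp: End_ring_def zero_hom_def dimodule_homD(1)
          intro!: extensionalityI[of _ "carrier M"] dest: dimodule_homD(2))
  qed (auto simp: End_ring_def add_hom zero_hom_closed M.a_ac dimodule_homD(1)
      intro!: restrict_ext)
  show "monoid (End_ring R M)"
    by (rule monoidI)
      (auto simp: End_ring_def compose_hom id_hom dimodule_homD(1) compose_eq
        intro!: extensionalityI[of _ "carrier M"] dest: dimodule_homD(2))
\<comment> \<open>What remains is distributivity: with the sum as the outer map it is pointwise,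
  with the sum as the inner map it is additivity of the outer one.\<close>
qed (auto simp: End_ring_def compose_def dimodule_homD(1,3) intro!: restrict_ext)

text \<open>By \<open>schur\<close> a nonzero endomorphism is bijective, and by
  \<open>inverse_hom\<close> its inverse is again an endomorphism.\<close>

lemma division_ring_End_ring:
  assumes "three_irreducible R e M"
  shows "division_ring (End_ring R M)"
proof -
  interpret E: ring "End_ring R M"
    by (rule ring_End_ring)
  have one_not_zero: "\<one>\<^bsub>End_ring R M\<^esub> \<noteq> \<zero>\<^bsub>End_ring R M\<^esub>"
  proof
    assume "\<one>\<^bsub>End_ring R M\<^esub> = \<zero>\<^bsub>End_ring R M\<^esub>"
    \<comment> \<open>If identity and zero map coincide, \<open>M\<close> is trivial and equals its
      halo, which must be proper.\<close>
    then have "x = \<zero>\<^bsub>M\<^esub>" if "x \<in> carrier M" for x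
      using that by (auto simp: End_ring_def zero_hom_def dest: fun_cong[of _ _ x])
    then have "carrier M = add_halo e M"
      using lact_zero[OF bar_unit_closed] by (auto simp: add_halo_def)
    then show False
      using three_irreducible_add_halo(2)[OF assms] by simp
  qed
  have "\<phi> \<in> Units (End_ring R M)"
    if \<phi>: "\<phi> \<in> carrier (End_ring R M)" "\<phi> \<noteq> \<zero>\<^bsub>End_ring R M\<^esub>" for \<phi>
  proof -
    interpret left_dimodule_hom R e M M \<phi>
      using \<phi>(1) by (intro left_dimodule_hom_self) (simp add: End_ring_def)
    have iso: "\<phi> \<in> dimodule_iso R M M"
      using schur[OF assms assms] \<phi>(2) by (simp add: End_ring_def)
    then have "bij_betw \<phi> (carrier M) (carrier M)"
      by (simp add: dimodule_iso_def)
    then show ?thesis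
      using inverse_hom[OF iso] \<phi>(1)
      by (auto simp: Units_def End_ring_def compose_inv_into_id compose_id_inv_into bij_betw_def
          intro!: bexI[of _ "restrict (inv_into (carrier M) \<phi>) (carrier M)"])
  qed
  \<comment> \<open>An inverse of zero would give one equal to zero.\<close>
  moreover have "\<zero>\<^bsub>End_ring R M\<^esub> \<notin> Units (End_ring R M)"
    using one_not_zero by (auto simp: Units_def)
  ultimately have "Units (End_ring R M) = carrier (End_ring R M) - {\<zero>\<^bsub>End_ring R M\<^esub>}"
    by (auto simp: Units_def)
  then show ?thesis
    by (intro division_ring.intro division_ring_axioms.intro ring_End_ring one_not_zero)
qed

end

theorem proposition3p2:
  fixes R :: "('a, 'm) diring_scheme" and e :: 'a
    and M :: "('a, 'b, 'n) dimodule_scheme" and N :: "('a, 'c, 'k) dimodule_scheme"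
  assumes "left_diring R" and "e \<in> left_bar_units R"
    and "three_irreducible R e M" and "three_irreducible R e N"
  shows "(\<forall>\<phi> \<in> dimodule_hom R M N. \<phi> = zero_hom M N \<or> \<phi> \<in> dimodule_iso R M N)
    \<and> division_ring (End_ring R M)"
proof (intro conjI ballI)
  have modules: "left_dimodule R e M" "left_dimodule R e N"
    using assms(3,4) by (simp_all add: three_irreducible_def)
  show "division_ring (End_ring R M)"
    by (rule left_dimodule.division_ring_End_ring[OF modules(1) assms(3)])
  fix \<phi>
  assume "\<phi> \<in> dimodule_hom R M N"
  then have "left_dimodule_hom R e M N \<phi>"
    by (intro left_dimodule_hom.intro left_dimodule_hom_axioms.intro modules)
  then show "\<phi> = zero_hom M N \<or> \<phi> \<in> dimodule_iso R M N"
    by (rule left_dimodule_hom.schur[OF _ assms(3,4)])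
qed

end
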